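(* Let $\mathcal{P}$ be a finite index set and $\{A_p : p\in\mathcal{P}\}$ a collection of real $n\times n$ matrices, each of which is either stable or unstable. Let $\mathcal{G}$ be a directed graph on the subsystems such that its subgraph $\mathcal{G}_u$ is acyclic, and let $\mathbb{M}$ be a nonempty compact set of real $n\times n$ matrices not containing the zero matrix. Then there exist $\tau^*\ge0$, $\eta^*>0$ and a collection $\mathcal{R}=\{R_{(p,q)} : p,q\in\mathcal{P}\}\subseteq\mathbb{M}$ of (nonzero) reset matrices such that the reset switched system $\dot x(t)=A_{\sigma(t)}x(t)$, $x(t_k)=R_{(\sigma(t_{k-1}),\sigma(t_k))}\,x(t_k^-)$ ($k\ge1$) is stable for all switching signals $\sigma\in\mathcal{S}^{\mathcal{G}}[\tau^*,\eta^*]$.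
   Context: A real matrix is called stable if all its eigenvalues have negative real part, and unstable if at least one eigenvalue has positive real part. A switching signal is a right-continuous piecewise constant function $\sigma:[0,\infty)\to\mathcal{P}$ whose set of discontinuities $\{t_k\}_{k\ge1}$ (switching times) is an increasing sequence with $t_k\uparrow\infty$; put $t_0=0$. Graph: $\mathcal{G}$ is a directed graph with vertices the subsystems $A_p$, identified with $p\in\mathcal{P}$, such that every $p$ has at least one outgoing edge $(p,q)\in\mathcal{E}(\mathcal{G})$. $\mathcal{G}_u$ is the subgraph with the same vertices and with edges $\{(p,q)\in\mathcal{E}(\mathcal{G}) : A_p \text{ unstable}\}$. A signal $\sigma$ is $\mathcal{G}$-admissible if $(\sigma(t_{k-1}),\sigma(t_k))\in\mathcal{E}(\mathcal{G})$ for all $k\ge1$. For $\tau\ge 0$, $\eta>0$, $\mathcal{S}^{\mathcal{G}}[\tau,\eta]$ is the set of $\mathcal{G}$-admissible switching signals such that for all $k\ge1$: $t_k-t_{k-1}\ge\tau$ if $A_{\sigma(t_{k-1})}$ is stable, and $t_k-t_{k-1}\le\eta$ if $A_{\sigma(t_{k-1})}$ is unstable. In the reset switched system, $\dot x=A_{\sigma(t)}x$ holds on each $[t_{k-1},t_k)$ and $x(t_k^-)=\lim_{t\to t_k^-}x(t)$. The system (for fixed $\sigma$) is stable if for every $\epsilon>0$ there is $\delta>0$ such that $\|x(0)\|<\delta$ implies $\|x(t)\|<\epsilon$ for all $t>0$ (Euclidean norm). *)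

theory Defs
  imports "HOL-Analysis.Analysis"
begin

definition eigenvalue_of :: "real^'n^'n \<Rightarrow> complex \<Rightarrow> bool" where
  "eigenvalue_of A c \<longleftrightarrow> (\<exists>v. v \<noteq> 0 \<and> map_matrix complex_of_real A *v v = c *s v)"

definition stable_matrix :: "real^'n^'n \<Rightarrow> bool" where
  "stable_matrix A \<longleftrightarrow> (\<forall>c. eigenvalue_of A c \<longrightarrow> Re c < 0)"

definition unstable_matrix :: "real^'n^'n \<Rightarrow> bool" where
  "unstable_matrix A \<longleftrightarrow> (\<exists>c. eigenvalue_of A c \<and> Re c > 0)"

text \<open>Continuity of a signal on the half-line refers to the discrete topology on the index type,
  so it means being locally constant. The values of a signal at negative times are irrelevant.\<close>

definition discontinuities :: "(real \<Rightarrow> 'p) \<Rightarrow> real set" where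
  "discontinuities \<sigma> = {t \<in> {0..}. \<not> (\<forall>\<^sub>F s in at t within {0..}. \<sigma> s = \<sigma> t)}"

text \<open>The sequence 0 = t_0 < t_1 < t_2 < ... in which t_k, for positive k, is the k-th
  discontinuity. Only used for signals whose discontinuities can be enumerated in this way.\<close>

primrec switching_time :: "(real \<Rightarrow> 'p) \<Rightarrow> nat \<Rightarrow> real" where
  "switching_time \<sigma> 0 = 0"
| "switching_time \<sigma> (Suc k) = Inf {t \<in> discontinuities \<sigma>. switching_time \<sigma> k < t}"

lemma switching_time_eqI:
  assumes "t 0 = 0" "strict_mono t" "discontinuities \<sigma> = range (\<lambda>k. t (Suc k))"
  shows "switching_time \<sigma> k = t k"
proof (induction k)
  case 0
  then show ?case using assms(1) by simp
next
  case (Suc k)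
  have "Inf {s \<in> discontinuities \<sigma>. t k < s} = t (Suc k)"
  proof (rule cInf_eq_minimum)
    show "t (Suc k) \<in> {s \<in> discontinuities \<sigma>. t k < s}"
      using assms(2,3) by (auto simp: strict_mono_less)
    show "t (Suc k) \<le> s" if "s \<in> {s \<in> discontinuities \<sigma>. t k < s}" for s
      using that assms(2,3) by (auto simp: strict_mono_less strict_mono_less_eq)
  qed
  then show ?case using Suc by simp
qed

text \<open>Being constant on the intervals closed on the left and open on the right encodes both
  piecewise constancy and right-continuity.\<close>

definition switching_signal :: "'p set \<Rightarrow> (real \<Rightarrow> 'p) \<Rightarrow> bool" where
  "switching_signal P \<sigma> \<longleftrightarrow>
     \<sigma> ` {0..} \<subseteq> P \<and>
     discontinuities \<sigma> = range (\<lambda>k. switching_time \<sigma> (Suc k)) \<and>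
     strict_mono (switching_time \<sigma>) \<and>
     filterlim (switching_time \<sigma>) at_top sequentially \<and>
     (\<forall>k. \<sigma> constant_on {switching_time \<sigma> k..<switching_time \<sigma> (Suc k)})"

definition unstable_edges :: "('p \<Rightarrow> real^'n^'n) \<Rightarrow> ('p \<times> 'p) set \<Rightarrow> ('p \<times> 'p) set" where
  "unstable_edges A E = {(p, q) \<in> E. unstable_matrix (A p)}"

definition admissible :: "('p \<times> 'p) set \<Rightarrow> (real \<Rightarrow> 'p) \<Rightarrow> bool" where
  "admissible E \<sigma> \<longleftrightarrow>
     (\<forall>k. (\<sigma> (switching_time \<sigma> k), \<sigma> (switching_time \<sigma> (Suc k))) \<in> E)"

definition dwell_flee_signals ::
  "'p set \<Rightarrow> ('p \<Rightarrow> real^'n^'n) \<Rightarrow> ('p \<times> 'p) set \<Rightarrow> real \<Rightarrow> real \<Rightarrow> (real \<Rightarrow> 'p) set" where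
  "dwell_flee_signals P A E \<tau> \<eta> =
     {\<sigma>. switching_signal P \<sigma> \<and> admissible E \<sigma> \<and>
        (\<forall>k. (stable_matrix (A (\<sigma> (switching_time \<sigma> k))) \<longrightarrow>
                switching_time \<sigma> (Suc k) - switching_time \<sigma> k \<ge> \<tau>) \<and>
             (unstable_matrix (A (\<sigma> (switching_time \<sigma> k))) \<longrightarrow>
                switching_time \<sigma> (Suc k) - switching_time \<sigma> k \<le> \<eta>))}"

text \<open>At a switching time the derivative is the right-hand one.\<close>

definition reset_solution ::
  "('p \<Rightarrow> real^'n^'n) \<Rightarrow> ('p \<times> 'p \<Rightarrow> real^'n^'n) \<Rightarrow> (real \<Rightarrow> 'p) \<Rightarrow> (real \<Rightarrow> real^'n) \<Rightarrow> bool" where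
  "reset_solution A R \<sigma> x \<longleftrightarrow>
     (\<forall>k. \<forall>t \<in> {switching_time \<sigma> k..<switching_time \<sigma> (Suc k)}.
        (x has_vector_derivative A (\<sigma> t) *v x t)
          (at t within {switching_time \<sigma> k..<switching_time \<sigma> (Suc k)})) \<and>
     (\<forall>k. \<exists>l. (x \<longlongrightarrow> l) (at_left (switching_time \<sigma> (Suc k))) \<and>
        x (switching_time \<sigma> (Suc k)) =
          R (\<sigma> (switching_time \<sigma> k), \<sigma> (switching_time \<sigma> (Suc k))) *v l)"

definition reset_system_stable ::
  "('p \<Rightarrow> real^'n^'n) \<Rightarrow> ('p \<times> 'p \<Rightarrow> real^'n^'n) \<Rightarrow> (real \<Rightarrow> 'p) \<Rightarrow> bool" where
  "reset_system_stable A R \<sigma> \<longleftrightarrow>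
     (\<forall>\<epsilon>>0. \<exists>\<delta>>0. \<forall>x. reset_solution A R \<sigma> x \<longrightarrow>
        norm (x 0) < \<delta> \<longrightarrow> (\<forall>t>0. norm (x t) < \<epsilon>))"

end

theory Submission
  imports Defs "HOL-Computational_Algebra.Fundamental_Theorem_Algebra"
begin

text \<open>All reset matrices are taken equal to one element of \<open>M\<close>, and \<open>\<eta> = 1\<close>. Since \<open>\<G>\<^sub>u\<close> is acyclic,
  the number of vertices reachable from a vertex in \<open>\<G>\<^sub>u\<close> decreases strictly along its edges. The
  norm of the state at the switching times, weighted by a suitable constant \<open>B\<close> to the power of
  this rank, is therefore nonincreasing across unstable intervals, and across stable ones it is
  nonincreasing once the dwell time is long enough.

  Exponential decay of the flow of a stable matrix is obtained without matrix exponentials or normal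
  forms. Some product of factors \<open>A - c\<close> with eigenvalues \<open>c\<close> vanishes: factor an annihilating
  polynomial over the complex numbers and drop the factors that are injective. Applying
  the factors one after another to a solution reduces the decay estimate to scalar
  equations \<open>z' = c z + w\<close> with \<open>w\<close> decaying.\<close>

section \<open>Polynomials of a complex matrix and products of eigenvalue factors\<close>

definition poly_matrix_vec :: "complex^'n^'n \<Rightarrow> complex poly \<Rightarrow> complex^'n \<Rightarrow> complex^'n" where
  "poly_matrix_vec A p v = (\<Sum>i\<le>degree p. coeff p i *s ((*v) A ^^ i) v)"

text \<open>Coefficients beyond the degree vanish, so polynomials of different degrees can be summed
  over a common range.\<close>

lemma poly_matrix_vec_upto:
  assumes "degree p \<le> n"
  shows "poly_matrix_vec A p v = (\<Sum>i\<le>n. coeff p i *s ((*v) A ^^ i) v)"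
  unfolding poly_matrix_vec_def
  by (rule sum.mono_neutral_left) (use assms in \<open>auto simp: coeff_eq_0\<close>)

lemma poly_matrix_vec_linear_factor:
  "poly_matrix_vec A ([:- c, 1:] * q) v = A *v poly_matrix_vec A q v - c *s poly_matrix_vec A q v"
proof -
  let ?n = "Suc (degree q)"
  let ?f = "\<lambda>i. ((*v) A ^^ i) v"
  \<comment> \<open>Multiplication by the variable is \<open>pCons 0\<close>, a shift of the
    coefficients that amounts to one more application of \<open>A\<close>.\<close>
  have eq: "[:- c, 1:] * q = pCons 0 q - smult c q" by simp
  have "degree ([:- c, 1:] * q) \<le> ?n"
    using degree_mult_le[of "[:-c,1:]" q] by simp
  then have "poly_matrix_vec A ([:- c, 1:] * q) v = (\<Sum>i\<le>?n. coeff ([:- c, 1:] * q) i *s ?f i)"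
    by (rule poly_matrix_vec_upto)
  also have "\<dots> = (\<Sum>i\<le>?n. coeff (pCons 0 q) i *s ?f i) - (\<Sum>i\<le>?n. coeff (smult c q) i *s ?f i)"
    unfolding eq sum_subtractf[symmetric] by (simp add: vector_sub_rdistrib)
  also have "(\<Sum>i\<le>?n. coeff (pCons 0 q) i *s ?f i) = (\<Sum>i\<le>degree q. coeff q i *s (A *v ?f i))"
    by (subst sum.atMost_Suc_shift) (simp add: coeff_eq_0 del: sum.atMost_Suc)
  also have "\<dots> = A *v poly_matrix_vec A q v"
    by (simp add: poly_matrix_vec_def vector_scalar_commute linear_sum[OF matrix_vector_mul_linear])
  also have "(\<Sum>i\<le>?n. coeff (smult c q) i *s ?f i) = c *s (\<Sum>i\<le>?n. coeff q i *s ?f i)"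
    by (simp add: vec.scale_sum_right vector_smult_assoc)
  also have "(\<Sum>i\<le>?n. coeff q i *s ?f i) = poly_matrix_vec A q v"
    by (rule poly_matrix_vec_upto[symmetric]) simp
  finally show ?thesis .
qed

text \<open>The powers \<open>P 0\<close> to \<open>P ?N\<close> are one more than the real
  dimension of the matrix space, so they satisfy a nontrivial linear relation; its real coefficients
  are those of the polynomial.\<close>

lemma annihilating_polynomial:
  fixes A :: "complex^'n^'n"
  obtains p where "p \<noteq> 0" "\<And>v. poly_matrix_vec A p v = 0"
proof -
  let ?N = "DIM(complex^'n^'n)"
  define P where "P i = ((**) A ^^ i) (mat 1)" for i
  have P: "P i *v v = ((*v) A ^^ i) v" for i v
    unfolding P_def by (induction i) (simp_all add: matrix_vector_mul_assoc[symmetric])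
  have "\<exists>c. (\<exists>i\<le>?N. c i \<noteq> 0) \<and> (\<Sum>i\<le>?N. c i *\<^sub>R P i) = 0"
  \<comment> \<open>Counting the set of powers needs them to be distinct. If two coincide, their
    difference is already a relation.\<close>
  proof (cases "inj_on P {..?N}")
    case True
    have "dependent (P ` {..?N})"
      using True by (intro dependent_biggerset) (auto simp: card_image)
    then obtain u where u: "(\<Sum>v\<in>P ` {..?N}. u v *\<^sub>R v) = 0" "\<exists>v\<in>P ` {..?N}. u v \<noteq> 0"
      by (auto simp: real_vector.dependent_finite)
    then show ?thesis
      by (intro exI[of _ "u \<circ> P"]) (auto simp: sum.reindex[OF True] simp del: DIM_cart)
  next
    case False
    then obtain i j where ij: "i \<le> ?N" "j \<le> ?N" "i \<noteq> j" "P i = P j"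
      by (auto simp: inj_on_def)
    define c where "c k = (if k = i then 1 else if k = j then - 1 else 0 :: real)" for k
    have "(\<Sum>k\<le>?N. c k *\<^sub>R P k) = (\<Sum>k\<in>{i, j}. c k *\<^sub>R P k)"
      by (rule sum.mono_neutral_right) (use ij in \<open>auto simp: c_def\<close>)
    also have "\<dots> = 0" using ij by (simp add: c_def)
    finally show ?thesis using ij by (intro exI[of _ c]) (auto simp: c_def)
  qed
  then obtain c k where k: "k \<le> ?N" "c k \<noteq> 0" and c: "(\<Sum>i\<le>?N. c i *\<^sub>R P i) = 0" by blast
  define p where "p = (\<Sum>i\<le>?N. monom (complex_of_real (c i)) i)"
  have coeff: "coeff p i = (if i \<le> ?N then of_real (c i) else 0)" for i
    by (simp add: p_def coeff_sum if_distrib cong: if_cong)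
  have deg: "degree p \<le> ?N" by (rule degree_le) (simp add: coeff)
  have sm: "of_real r *s v = r *\<^sub>R v" for r and v :: "complex^'n"
    by (simp add: vec_eq_iff scaleR_conv_of_real[symmetric])
  have lin: "linear (\<lambda>M :: complex^'n^'n. M *v v)" for v
    by (rule linearI) (simp_all add: matrix_vector_mult_add_rdistrib,
        simp add: vec_eq_iff matrix_vector_mult_def scaleR_sum_right)
  have "poly_matrix_vec A p v = 0" for v
  proof -
    have "poly_matrix_vec A p v = (\<Sum>i\<le>?N. c i *\<^sub>R (P i *v v))"
      unfolding poly_matrix_vec_upto[OF deg] P by (rule sum.cong) (simp_all add: coeff sm)
    also have "\<dots> = (\<Sum>i\<le>?N. c i *\<^sub>R P i) *v v"
      by (subst linear_sum[OF lin]) (simp add: linear_scale[OF lin])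
    finally show ?thesis using c by simp
  qed
  moreover have "p \<noteq> 0"
    using coeff[of k] k by auto
  ultimately show thesis using that by blast
qed


lemma matrix_power_commute_shift:
  "((*v) A ^^ i) (A *v v - c *s v) = A *v ((*v) A ^^ i) v - c *s ((*v) A ^^ i) v"
  for A :: "complex^'n^'n"
  by (induction i) (simp_all add: matrix_vector_mult_diff_distrib vector_scalar_commute)

text \<open>Since \<open>fold\<close> applies the head of the list first, a factor split off on the
  outside of a polynomial has to be moved to the inside.\<close>

lemma poly_matrix_vec_commute_shift:
  "poly_matrix_vec A p (A *v v - c *s v) = A *v poly_matrix_vec A p v - c *s poly_matrix_vec A p v"
  unfolding poly_matrix_vec_def matrix_power_commute_shift
  by (simp add: vector_scalar_commute linear_sum[OF matrix_vector_mul_linear] vector_ssub_ldistrib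
      sum_subtractf vec.scale_sum_right vector_smult_assoc mult.commute)

text \<open>Induction on the degree, splitting off a root \<open>c\<close>. If \<open>c\<close> is
  an eigenvalue, it is put on the list and the induction hypothesis is applied to the image of
  \<open>v\<close> under \<open>A - c\<close>. Otherwise \<open>A - c\<close> is injective, so the
  cofactor \<open>q\<close> already annihilates \<open>v\<close>. A nonzero constant annihilates
  only the zero vector, which is what the empty list says.\<close>

lemma eigenvalue_factors_of_polynomial:
  fixes A :: "complex^'n^'n"
  assumes "p \<noteq> 0"
  shows "\<exists>cs. (\<forall>c\<in>set cs. \<exists>v. v \<noteq> 0 \<and> A *v v = c *s v) \<and>
    (\<forall>v. poly_matrix_vec A p v = 0 \<longrightarrow> fold (\<lambda>c w. A *v w - c *s w) cs v = 0)"
  using assms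
proof (induction "degree p" arbitrary: p)
  case 0
  then obtain a where "p = [:a:]" "a \<noteq> 0" by (metis degree_eq_zeroE pCons_eq_0_iff)
  then show ?case
    by (intro exI[of _ "[]"]) (simp add: poly_matrix_vec_def)
next
  case (Suc n)
  then have "\<not> constant (poly p)" by (simp add: constant_degree)
  then obtain c where "poly p c = 0" using fundamental_theorem_of_algebra by blast
  then obtain q where q: "p = [:- c, 1:] * q" by (auto simp: poly_eq_0_iff_dvd)
  with Suc.prems have "q \<noteq> 0" by auto
  with Suc.hyps(2) have "n = degree q" unfolding q by (subst (asm) degree_mult_eq) auto
  with Suc.hyps(1) \<open>q \<noteq> 0\<close> obtain cs
    where eig: "\<forall>c\<in>set cs. \<exists>v. v \<noteq> 0 \<and> A *v v = c *s v"
      and cs: "\<And>v. poly_matrix_vec A q v = 0 \<Longrightarrow> fold (\<lambda>c w. A *v w - c *s w) cs v = 0"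
    by blast
  show ?case
  proof (cases "\<exists>v. v \<noteq> 0 \<and> A *v v = c *s v")
    case True
    then show ?thesis
      using eig cs
      by (intro exI[of _ "c # cs"])
         (auto simp: q poly_matrix_vec_linear_factor poly_matrix_vec_commute_shift simp del: mult_pCons_left)
  next
    case False
    then show ?thesis
      using eig cs
      by (intro exI[of _ cs]) (auto simp: q poly_matrix_vec_linear_factor simp del: mult_pCons_left)
  qed
qed

lemma annihilating_eigenvalues:
  fixes A :: "complex^'n^'n"
  obtains cs where "\<forall>c\<in>set cs. \<exists>v. v \<noteq> 0 \<and> A *v v = c *s v"
    and "\<And>v. fold (\<lambda>c w. A *v w - c *s w) cs v = 0"
proof -
  obtain p where "p \<noteq> 0" "\<And>v. poly_matrix_vec A p v = 0" using annihilating_polynomial[of A] by metis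
  with eigenvalue_factors_of_polynomial[of p A] show thesis using that by blast
qed

section \<open>Growth and decay estimates for linear differential equations\<close>

text \<open>The integrating factor turns the equation into
  \<open>u' = exp (- c * (s - a)) * w\<close>, and the mean value inequality bounds the increment of
  \<open>u\<close>. The strict gap between \<open>Re c\<close> and \<open>- r\<close> keeps the rate
  \<open>r\<close> of the forcing term \<open>w\<close>.\<close>

lemma scalar_linear_ode_bound:
  fixes z w :: "real \<Rightarrow> complex"
  assumes z: "\<And>t. t \<in> {a..<b} \<Longrightarrow> (z has_vector_derivative c * z t + w t) (at t within {a..<b})"
    and w: "\<And>t. t \<in> {a..<b} \<Longrightarrow> cmod (w t) \<le> K * exp (- r * (t - a))"
    and c: "Re c < - r" and t: "t \<in> {a..<b}"
  shows "cmod (z t) \<le> (cmod (z a) + K / (- r - Re c)) * exp (- r * (t - a))"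
proof -
  define \<beta> where "\<beta> = - r - Re c"
  have \<beta>: "\<beta> > 0" using c by (simp add: \<beta>_def)
  have "a \<in> {a..<b}" using t by simp
  from w[OF this] have "0 \<le> K" by (auto intro: order_trans[OF norm_ge_zero])
  define u where "u s = exp (- c * of_real (s - a)) * z s" for s
  \<comment> \<open>An antiderivative of the majorant of the norm of the derivative of
    \<open>u\<close>.\<close>
  define \<phi> where "\<phi> s = K / \<beta> * exp (\<beta> * (s - a))" for s
  have u: "(u has_vector_derivative exp (- c * of_real (s - a)) * w s) (at s within {a..<b})"
    if "s \<in> {a..<b}" for s
  proof -
    have exp_deriv: "((\<lambda>s. exp (- c * of_real (s - a))) has_vector_derivative exp (- c * of_real (s - a)) * (- c))
        (at s within {a..<b})"
    proof -
      have "((\<lambda>z. exp (- c * (z - of_real a))) has_field_derivative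
          exp (- c * (of_real s - of_real a)) * (- c)) (at (of_real s))"
        by (rule DERIV_fun_exp) (auto intro!: derivative_eq_intros)
      from has_vector_derivative_real_field[OF this] show ?thesis
        unfolding of_real_diff .
    qed
    have eq: "e * (c * x + y) + e * (- c) * x = e * y" for e x y :: complex
      by (simp add: algebra_simps)
    from has_vector_derivative_mult[OF exp_deriv z[OF that]] show ?thesis
      unfolding u_def eq .
  qed
  have \<phi>: "(\<phi> has_vector_derivative K * exp (\<beta> * (s - a))) (at s within S)" for s S
    unfolding \<phi>_def has_real_derivative_iff_has_vector_derivative[symmetric]
    using \<beta> by (auto intro!: derivative_eq_intros)
  have le: "cmod (exp (- c * of_real (s - a)) * w s) \<le> K * exp (\<beta> * (s - a))" if "s \<in> {a..<b}" for s
  proof -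
    have "cmod (exp (- c * of_real (s - a)) * w s) \<le> exp (- Re c * (s - a)) * (K * exp (- r * (s - a)))"
      unfolding norm_mult by (intro mult_mono w[OF that]) auto
    also have "\<dots> = K * exp (\<beta> * (s - a))"
      by (simp add: \<beta>_def exp_add[symmetric] algebra_simps)
    finally show ?thesis .
  qed
  have "norm (u t - u a) \<le> \<phi> t - \<phi> a"
  proof (cases "a = t")
    case False
    with t have "a < t" by simp
    then show ?thesis
    proof (rule differentiable_bound_general)
      show "continuous_on {a..t} \<phi>"
        unfolding \<phi>_def by (intro continuous_intros)
      have "continuous_on {a..<b} u"
        using u by (rule continuous_on_vector_derivative)
      then show "continuous_on {a..t} u"
        by (rule continuous_on_subset) (use t in auto)
      fix s assume s: "a < s" "s < t"
      then have "at s within {a..<b} = at s"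
        using t by (intro at_within_interior) simp
      moreover have "s \<in> {a..<b}" using s t by simp
      ultimately show "(u has_vector_derivative exp (- c * of_real (s - a)) * w s) (at s)"
        using u[of s] by simp
      show "(\<phi> has_vector_derivative K * exp (\<beta> * (s - a))) (at s)" by (rule \<phi>)
      show "norm (exp (- c * of_real (s - a)) * w s) \<le> K * exp (\<beta> * (s - a))"
        using le s t by simp
    qed
  qed simp
  moreover have "0 \<le> \<phi> a" using \<open>0 \<le> K\<close> \<beta> by (simp add: \<phi>_def)
  moreover have "u a = z a" by (simp add: u_def)
  moreover have "norm (u t) \<le> norm (u t - u a) + norm (u a)"
    using norm_triangle_ineq[of "u t - u a" "u a"] by simp
  ultimately have "cmod (u t) \<le> cmod (z a) + \<phi> t" by simp
  \<comment> \<open>The exponential is at least 1, so the initial value can be put under the same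
    factor as the forcing.\<close>
  also have "\<dots> \<le> cmod (z a) * exp (\<beta> * (t - a)) + \<phi> t"
    using \<beta> t by (simp add: mult_le_cancel_left1)
  also have "\<dots> = (cmod (z a) + K / \<beta>) * exp (\<beta> * (t - a))"
    by (simp add: \<phi>_def algebra_simps)
  finally have ut: "cmod (u t) \<le> (cmod (z a) + K / \<beta>) * exp (\<beta> * (t - a))" .
  \<comment> \<open>Undoing the integrating factor restores the rate, because
    \<open>Re c + \<beta> = - r\<close>.\<close>
  have "cmod (z t) = exp (Re c * (t - a)) * cmod (u t)"
    by (simp add: u_def norm_mult exp_add[symmetric])
  also have "\<dots> \<le> exp (Re c * (t - a)) * ((cmod (z a) + K / \<beta>) * exp (\<beta> * (t - a)))"
    using ut by simp
  also have "\<dots> = (cmod (z a) + K / \<beta>) * exp (- r * (t - a))"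
    by (simp add: \<beta>_def exp_add[symmetric] algebra_simps)
  finally show ?thesis by (simp add: \<beta>_def)
qed

text \<open>The map is multiplication by the single matrix \<open>A - mat c\<close>. Boundedness
  serves both to differentiate its composition with a solution and to estimate its norm.\<close>

lemma bounded_linear_shift:
  "bounded_linear (\<lambda>v. A *v v - c *s v)" for A :: "complex^'n^'n"
proof -
  have "A *v v - c *s v = (A - mat c) *v v" for v
    by (simp add: matrix_vector_mult_diff_rdistrib vec_eq_iff matrix_vector_mult_def mat_def
        left_diff_distrib sum_subtractf if_distrib[of "\<lambda>x. x * _"] sum.delta cong: if_cong)
  then show ?thesis by simp
qed

text \<open>Induction on the list: the image of a solution under \<open>A - c\<close> is again a
  solution, annihilated by the remaining factors, so it decays and acts as the forcing term in each
  component. The constant is quantified before the solution and the interval, which makes it uniform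
  and lets the induction hypothesis apply to the image.\<close>

lemma annihilated_solution_bound:
  fixes A :: "complex^'n^'n"
  assumes "\<forall>c\<in>set cs. Re c < - r"
  shows "\<exists>C\<ge>0. \<forall>a b y i t. (\<forall>t\<in>{a..<b}. (y has_vector_derivative A *v y t) (at t within {a..<b})) \<longrightarrow>
    (\<forall>t\<in>{a..<b}. fold (\<lambda>c w. A *v w - c *s w) cs (y t) = 0) \<longrightarrow> t \<in> {a..<b} \<longrightarrow>
    cmod (y t $ i) \<le> C * norm (y a) * exp (- r * (t - a))"
  using assms
proof (induction cs)
  case Nil
  then show ?case by (intro exI[of _ 0]) auto
next
  case (Cons c cs)
  then obtain C where C: "C \<ge> 0" and bound:
    "\<And>a b y i t. (\<forall>t\<in>{a..<b}. (y has_vector_derivative A *v y t) (at t within {a..<b})) \<Longrightarrow>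
      (\<forall>t\<in>{a..<b}. fold (\<lambda>c w. A *v w - c *s w) cs (y t) = 0) \<Longrightarrow> t \<in> {a..<b} \<Longrightarrow>
      cmod (y t $ i) \<le> C * norm (y a) * exp (- r * (t - a))"
    by auto
  let ?L = "\<lambda>v. A *v v - c *s v"
  interpret L: bounded_linear ?L by (rule bounded_linear_shift)
  obtain D where D: "D > 0" "\<And>v. norm (?L v) \<le> norm v * D" using L.pos_bounded by blast
  define \<beta> where "\<beta> = - r - Re c"
  have \<beta>: "\<beta> > 0" using Cons.prems by (simp add: \<beta>_def)
  \<comment> \<open>The summand 1 accounts for the initial value, \<open>C * D / \<beta>\<close> for
    the forcing term, whose initial norm is at most \<open>D * norm (y a)\<close>.\<close>
  have "cmod (y t $ i) \<le> (1 + C * D / \<beta>) * norm (y a) * exp (- r * (t - a))"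
    if y: "\<forall>t\<in>{a..<b}. (y has_vector_derivative A *v y t) (at t within {a..<b})"
      and ann: "\<forall>t\<in>{a..<b}. fold (\<lambda>c w. A *v w - c *s w) (c # cs) (y t) = 0"
      and t: "t \<in> {a..<b}" for a b y i t
  proof -
    have w: "((\<lambda>t. ?L (y t)) has_vector_derivative A *v ?L (y t)) (at t within {a..<b})"
      if "t \<in> {a..<b}" for t
      using L.has_vector_derivative[OF y[rule_format, OF that]]
      by (simp add: matrix_vector_mult_diff_distrib vector_scalar_commute)
    have wi: "cmod (?L (y t) $ i) \<le> C * norm (?L (y a)) * exp (- r * (t - a))" if "t \<in> {a..<b}" for t
      using w ann that by (intro bound[of a b "\<lambda>t. ?L (y t)"]) auto
    have "cmod (y t $ i) \<le> (cmod (y a $ i) + C * norm (?L (y a)) / (- r - Re c)) * exp (- r * (t - a))"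
    proof (rule scalar_linear_ode_bound[where w = "\<lambda>t. ?L (y t) $ i", OF _ wi _ t])
      show "((\<lambda>t. y t $ i) has_vector_derivative c * y t $ i + ?L (y t) $ i) (at t within {a..<b})"
        if "t \<in> {a..<b}" for t
        using bounded_linear.has_vector_derivative[OF bounded_linear_vec_nth y[rule_format, OF that], of i]
        by simp
      show "Re c < - r" using Cons.prems by simp
    qed
    also have "\<dots> \<le> (norm (y a) + C * (norm (y a) * D) / \<beta>) * exp (- r * (t - a))"
      unfolding \<beta>_def[symmetric] using C \<beta> D
      by (intro mult_right_mono add_mono divide_right_mono mult_left_mono Finite_Cartesian_Product.norm_nth_le) auto
    also have "\<dots> = (1 + C * D / \<beta>) * norm (y a) * exp (- r * (t - a))"
      using \<beta> by (simp add: field_simps)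
    finally show ?thesis .
  qed
  moreover have "0 \<le> 1 + C * D / \<beta>" using C D \<beta> by simp
  ultimately show ?case by blast
qed

text \<open>The growth bound holds for every matrix, with negative \<open>r\<close> allowed, so that it also plays the
  role of Gronwall's inequality on the intervals governed by an unstable subsystem.\<close>

lemma linear_ode_bound:
  fixes A :: "real^'n^'n"
  obtains C r where "C \<ge> 0" "stable_matrix A \<Longrightarrow> r > 0"
    "\<And>a b x t. (\<And>t. t \<in> {a..<b} \<Longrightarrow> (x has_vector_derivative A *v x t) (at t within {a..<b})) \<Longrightarrow>
      t \<in> {a..<b} \<Longrightarrow> norm (x t) \<le> C * norm (x a) * exp (- r * (t - a))"
proof -
  let ?A = "map_matrix complex_of_real A"
  \<comment> \<open>An isometric embedding that carries real solutions to solutions of the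
    complexified system, where the eigenvalue factors live.\<close>
  define cplx where "cplx v = (\<chi> i. complex_of_real (v $ i))" for v :: "real^'n"
  have cplx_mult: "?A *v cplx v = cplx (A *v v)" for v
    by (simp add: cplx_def vec_eq_iff matrix_vector_mult_def map_matrix_def)
  have norm_cplx: "norm (cplx v) = norm v" for v
    by (simp add: cplx_def norm_vec_def)
  have bl: "bounded_linear cplx"
    by (rule bounded_linear_intro[of _ 1])
       (simp_all add: norm_cplx, simp_all add: cplx_def vec_eq_iff scaleR_conv_of_real[where 'a = complex])
  obtain cs where eig: "\<forall>c\<in>set cs. \<exists>v. v \<noteq> 0 \<and> ?A *v v = c *s v"
    and ann: "\<And>v. fold (\<lambda>c w. ?A *v w - c *s w) cs v = 0"
    using annihilating_eigenvalues[of ?A] by metis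
  \<comment> \<open>The entry \<open>- 2\<close> makes the maximum well defined without showing
    \<open>cs\<close> nonempty; being negative, it does not affect the sign of \<open>m\<close> in
    the stable case.\<close>
  define m where "m = Max (insert (- 2) (Re ` set cs))"
  have m: "Re c \<le> m" if "c \<in> set cs" for c using that by (simp add: m_def)
  \<comment> \<open>In both cases \<open>- r\<close> lies strictly above \<open>m\<close>, hence
    above every \<open>Re c\<close>; for negative \<open>m\<close> it stays below 0, so
    \<open>r\<close> is positive.\<close>
  define r where "r = (if m < 0 then - m / 2 else - m - 1)"
  have "\<forall>c\<in>set cs. Re c < - r"
  proof
    fix c assume "c \<in> set cs"
    from m[OF this] show "Re c < - r" by (simp add: r_def)
  qed
  from annihilated_solution_bound[OF this, of ?A] obtain C where C: "C \<ge> 0"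
    and bound: "\<And>a b y i t. (\<forall>t\<in>{a..<b}. (y has_vector_derivative ?A *v y t) (at t within {a..<b})) \<Longrightarrow>
      t \<in> {a..<b} \<Longrightarrow> cmod (y t $ i) \<le> C * norm (y a) * exp (- r * (t - a))"
    using ann by blast
  show thesis
  proof (rule that)
    show "0 \<le> real CARD('n) * C" using C by simp
    show "r > 0" if "stable_matrix A"
    proof -
      have "Re c < 0" if "c \<in> set cs" for c
        using that eig \<open>stable_matrix A\<close> by (auto simp: stable_matrix_def eigenvalue_of_def)
      then have "m < 0" by (simp add: m_def)
      then show ?thesis by (simp add: r_def)
    qed
    fix a b x t
    assume x: "\<And>t. t \<in> {a..<b} \<Longrightarrow> (x has_vector_derivative A *v x t) (at t within {a..<b})"
      and t: "t \<in> {a..<b}"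
    have y: "\<forall>t\<in>{a..<b}. ((\<lambda>t. cplx (x t)) has_vector_derivative ?A *v cplx (x t)) (at t within {a..<b})"
      using bounded_linear.has_vector_derivative[OF bl x] by (simp add: cplx_mult)
    have "\<bar>x t $ i\<bar> \<le> C * norm (x a) * exp (- r * (t - a))" for i
      using bound[OF y t, of i] by (simp add: norm_cplx) (simp add: cplx_def)
    \<comment> \<open>The sum of the component bounds dominates the Euclidean norm, whence the
      factor \<open>CARD('n)\<close>.\<close>
    then have "(\<Sum>i\<in>UNIV. \<bar>x t $ i\<bar>) \<le> real CARD('n) * (C * norm (x a) * exp (- r * (t - a)))"
      by (intro sum_bounded_above) simp
    then show "norm (x t) \<le> real CARD('n) * C * norm (x a) * exp (- r * (t - a))"
      using norm_le_l1_cart[of "x t"] by (simp add: mult.assoc)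
  qed
qed

section \<open>Left limits, ranks in an acyclic graph, and unbounded sequences\<close>

text \<open>At a switching time the value of the solution is already the reset state, so the flow
  estimate is carried to the left limit by continuity of its right-hand side.\<close>

lemma left_limit_bound:
  fixes x :: "real \<Rightarrow> 'a::real_normed_vector"
  assumes "a < b" and x: "(x \<longlongrightarrow> l) (at_left b)"
    and bound: "\<And>t. t \<in> {a..<b} \<Longrightarrow> norm (x t) \<le> c * exp (- r * (t - a))"
  shows "norm l \<le> c * exp (- r * (b - a))"
proof (rule tendsto_le)
  show "((\<lambda>t. norm (x t)) \<longlongrightarrow> norm l) (at_left b)"
    by (intro tendsto_intros x)
  show "((\<lambda>t. c * exp (- r * (t - a))) \<longlongrightarrow> c * exp (- r * (b - a))) (at_left b)"
    by (intro tendsto_intros)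
  show "\<forall>\<^sub>F t in at_left b. norm (x t) \<le> c * exp (- r * (t - a))"
    unfolding eventually_at_left[OF \<open>a < b\<close>] using \<open>a < b\<close> bound by (intro exI[of _ a]) auto
qed simp

definition out_rank :: "('a \<times> 'a) set \<Rightarrow> 'a \<Rightarrow> nat" where
  "out_rank G p = card {q. (p, q) \<in> G\<^sup>+}"

text \<open>Whatever \<open>q\<close> reaches, \<open>p\<close> reaches too; \<open>q\<close> itself
  is reached from \<open>p\<close> but, by acyclicity, not from \<open>q\<close>.\<close>

lemma out_rank_less:
  assumes "finite G" "acyclic G" "(p, q) \<in> G"
  shows "out_rank G q < out_rank G p"
  unfolding out_rank_def
proof (rule psubset_card_mono)
  have "{v. (p, v) \<in> G\<^sup>+} \<subseteq> snd ` (G\<^sup>+)" by force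
  then show "finite {v. (p, v) \<in> G\<^sup>+}"
    using assms(1) by (meson finite_imageI finite_subset finite_trancl)
  have "(q, q) \<notin> G\<^sup>+" using assms(2) by (simp add: acyclic_def)
  moreover have "(p, q) \<in> G\<^sup>+" using assms(3) by simp
  ultimately show "{v. (q, v) \<in> G\<^sup>+} \<subset> {v. (p, v) \<in> G\<^sup>+}"
    using assms(3) by (auto intro: trancl_into_trancl2)
qed

text \<open>Gives a bound on the exponents of the weights that does not depend on the
  vertex.\<close>

lemma out_rank_le:
  assumes "finite P" "G \<subseteq> P \<times> P"
  shows "out_rank G p \<le> card P"
  unfolding out_rank_def
  using assms trancl_subset_Sigma[of G P] by (intro card_mono) auto

text \<open>The least index at which \<open>f\<close> exceeds \<open>t\<close> is not 0, and it
  marks the right end of the interval.\<close>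

lemma unbounded_sequence_interval:
  fixes f :: "nat \<Rightarrow> real"
  assumes "filterlim f at_top sequentially" "f 0 \<le> t"
  obtains k where "t \<in> {f k..<f (Suc k)}"
proof -
  have "\<exists>k. t < f k"
    using assms(1) unfolding filterlim_at_top_dense eventually_sequentially by blast
  then obtain k where "t < f k" "\<forall>i<k. \<not> t < f i"
    using exists_least_iff[of "\<lambda>k. t < f k"] by blast
  with assms(2) show thesis
    using that[of "k - 1"] by (cases k) auto
qed

theorem theorem3p9:
  fixes P :: "'p set"
    and A :: "'p \<Rightarrow> real^'n^'n"
    and E :: "('p \<times> 'p) set"
    and M :: "(real^'n^'n) set"
  assumes "finite P"
    and "\<forall>p\<in>P. stable_matrix (A p) \<or> unstable_matrix (A p)"
    and "E \<subseteq> P \<times> P"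
    and "\<forall>p\<in>P. \<exists>q. (p, q) \<in> E"
    and "acyclic (unstable_edges A E)"
    and "M \<noteq> {}" and "compact M" and "0 \<notin> M"
  shows "\<exists>\<tau>\<ge>0. \<exists>\<eta>>0. \<exists>R. R ` (P \<times> P) \<subseteq> M \<and>
           (\<forall>\<sigma>\<in>dwell_flee_signals P A E \<tau> \<eta>. reset_system_stable A R \<sigma>)"
proof -

  \<comment> \<open>Constants and dwell time common to all signals\<close>
  from \<open>M \<noteq> {}\<close> obtain R0 where "R0 \<in> M" by blast
  obtain K where K: "K > 0" "\<And>v. norm (R0 *v v) \<le> norm v * K"
    using bounded_linear.pos_bounded[OF matrix_vector_mul_bounded_linear[of R0]] by blast
  have "\<exists>C r. C \<ge> 0 \<and> (stable_matrix (A p) \<longrightarrow> r > 0) \<and>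
     (\<forall>a b x. (\<forall>t\<in>{a..<b}. (x has_vector_derivative A p *v x t) (at t within {a..<b})) \<longrightarrow>
      (\<forall>t\<in>{a..<b}. norm (x t) \<le> C * norm (x a) * exp (- r * (t - a))))" for p
    by (rule linear_ode_bound[of "A p"]) blast
  then obtain C r where C: "\<And>p. C p \<ge> 0" and r: "\<And>p. stable_matrix (A p) \<Longrightarrow> r p > 0"
    and flow: "\<And>p a b x t. (\<forall>t\<in>{a..<b}. (x has_vector_derivative A p *v x t) (at t within {a..<b})) \<Longrightarrow>
      t \<in> {a..<b} \<Longrightarrow> norm (x t) \<le> C p * norm (x a) * exp (- r p * (t - a))"
    by metis
  \<comment> \<open>Bounds the flow of every subsystem at all nonnegative times if it is stable,
    where the exponent is at most 0, and up to time 1 otherwise. The sum replaces a maximum over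
    \<open>P\<close>, and the 1 keeps \<open>D\<close> positive.\<close>
  define D where "D = 1 + (\<Sum>p\<in>P. C p * exp \<bar>r p\<bar>)"
  have "D \<ge> 1" unfolding D_def using C by (simp add: sum_nonneg)
  have D: "C p * exp (- r p * s) \<le> D" if "p \<in> P" "0 \<le> s" "\<not> stable_matrix (A p) \<Longrightarrow> s \<le> 1" for p s
  proof -
    have "- r p * s \<le> \<bar>r p\<bar>"
    proof (cases "stable_matrix (A p)")
      case True
      with r[of p] \<open>0 \<le> s\<close> show ?thesis
        by (smt (verit) mult_nonneg_nonneg mult_minus_left)
    next
      case False
      with that have "\<bar>r p\<bar> * s \<le> \<bar>r p\<bar>" by (simp add: mult_left_le)
      moreover have "- r p * s \<le> \<bar>r p\<bar> * s" using \<open>0 \<le> s\<close> by (intro mult_right_mono) auto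
      ultimately show ?thesis by linarith
    qed
    then have "C p * exp (- r p * s) \<le> C p * exp \<bar>r p\<bar>"
      using C by (intro mult_left_mono) auto
    also have "\<dots> \<le> (\<Sum>p\<in>P. C p * exp \<bar>r p\<bar>)"
      using \<open>finite P\<close> \<open>p \<in> P\<close> C by (intro member_le_sum) auto
    finally show ?thesis by (simp add: D_def)
  qed
  \<comment> \<open>\<open>K * D\<close> bounds the growth over an unstable interval followed by a
    reset; the maximum with 1 makes powers of \<open>B\<close> increase with the exponent.\<close>
  define B where "B = max 1 (K * D)"
  have B: "B \<ge> 1" "K * D \<le> B" by (auto simp: B_def)
  define G where "G = unstable_edges A E"
  have "G \<subseteq> P \<times> P" using \<open>E \<subseteq> P \<times> P\<close> by (auto simp: G_def unstable_edges_def)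
  then have "finite G" using \<open>finite P\<close> finite_subset by blast
  let ?h = "out_rank G"
  let ?N = "card P"
  have h_le: "?h p \<le> ?N" for p
    using \<open>finite P\<close> \<open>G \<subseteq> P \<times> P\<close> by (rule out_rank_le)
  \<comment> \<open>Each left-hand side tends to 0 because \<open>r p\<close> is positive for stable
    \<open>A p\<close>; as \<open>P\<close> is finite, one \<tau> serves all indices.\<close>
  have "\<forall>\<^sub>F \<tau> in at_top. \<forall>p\<in>P. stable_matrix (A p) \<longrightarrow> K * C p * exp (- r p * \<tau>) * B ^ ?N \<le> 1"
  proof (intro eventually_ball_finite \<open>finite P\<close> ballI)
    fix p
    show "\<forall>\<^sub>F \<tau> in at_top. stable_matrix (A p) \<longrightarrow> K * C p * exp (- r p * \<tau>) * B ^ ?N \<le> 1"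
    proof (cases "stable_matrix (A p)")
      case True
      have "filterlim (\<lambda>\<tau>. - r p * \<tau>) at_bot at_top"
        using r[OF True] by (intro filterlim_tendsto_neg_mult_at_bot[OF tendsto_const] filterlim_ident) auto
      then have "((\<lambda>\<tau>. K * C p * exp (- r p * \<tau>) * B ^ ?N) \<longlongrightarrow> K * C p * 0 * B ^ ?N) at_top"
        by (intro tendsto_intros filterlim_compose[OF exp_at_bot])
      then have "((\<lambda>\<tau>. K * C p * exp (- r p * \<tau>) * B ^ ?N) \<longlongrightarrow> 0) at_top" by simp
      from order_tendstoD(2)[OF this, of 1] show ?thesis
        by (auto elim: eventually_mono)
    qed simp
  qed
  from eventually_conj[OF this eventually_ge_at_top[of 0]]
  obtain \<tau> where "\<tau> \<ge> 0"
    and \<tau>: "\<And>p. p \<in> P \<Longrightarrow> stable_matrix (A p) \<Longrightarrow> K * C p * exp (- r p * \<tau>) * B ^ ?N \<le> 1"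
    using eventually_happens'[OF trivial_limit_at_top_linorder] by fastforce

  \<comment> \<open>The weighted norm along a single signal\<close>
  have stable: "reset_system_stable A (\<lambda>_. R0) \<sigma>" if \<sigma>: "\<sigma> \<in> dwell_flee_signals P A E \<tau> 1" for \<sigma>
  proof -
    define t where "t = switching_time \<sigma>"
    define p where "p k = \<sigma> (t k)" for k
    have "t 0 = 0" by (simp add: t_def)
    have "strict_mono t" and t_top: "filterlim t at_top sequentially"
      and const: "\<And>k. \<sigma> constant_on {t k..<t (Suc k)}" and ran: "\<sigma> ` {0..} \<subseteq> P"
      using \<sigma> by (auto simp: dwell_flee_signals_def switching_signal_def t_def)
    then have t_less: "t k < t (Suc k)" for k by (simp add: strict_mono_less)
    have t_nonneg: "t k \<ge> 0" for k
      using \<open>strict_mono t\<close> \<open>t 0 = 0\<close> by (metis strict_mono_less_eq zero_le)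
    have pP: "p k \<in> P" for k using ran t_nonneg by (auto simp: p_def)
    have edge: "(p k, p (Suc k)) \<in> E" for k
      using \<sigma> by (simp add: dwell_flee_signals_def admissible_def t_def p_def)
    have dwell: "t (Suc k) - t k \<ge> \<tau>" if "stable_matrix (A (p k))" for k
      using \<sigma> that by (auto simp: dwell_flee_signals_def t_def p_def)
    have unstable: "unstable_matrix (A (p k))" if "\<not> stable_matrix (A (p k))" for k
      using assms(2) pP that by blast
    have flee: "t (Suc k) - t k \<le> 1" if "\<not> stable_matrix (A (p k))" for k
      using \<sigma> unstable[OF that] by (auto simp: dwell_flee_signals_def t_def p_def)
    have \<sigma>_eq: "\<sigma> s = p k" if "s \<in> {t k..<t (Suc k)}" for s k
      using const[of k] that t_less[of k] unfolding constant_on_def p_def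
      by (metis atLeastLessThan_iff order_refl)
    \<comment> \<open>\<open>B ^ ?N\<close> bounds the initial weight and \<open>D\<close> the flow
      since the last switching time; neither depends on the signal.\<close>
    have main: "norm (x s) \<le> D * B ^ ?N * norm (x 0)"
      if x: "reset_solution A (\<lambda>_. R0) \<sigma> x" and "s \<ge> 0" for x s
    proof -
      have ode: "\<forall>s\<in>{t k..<t (Suc k)}. (x has_vector_derivative A (p k) *v x s) (at s within {t k..<t (Suc k)})" for k
        using x \<sigma>_eq unfolding reset_solution_def t_def[symmetric] by metis
      have jump: "\<exists>l. (x \<longlongrightarrow> l) (at_left (t (Suc k))) \<and> x (t (Suc k)) = R0 *v l" for k
        using x unfolding reset_solution_def t_def[symmetric] by blast
      \<comment> \<open>The rank of the current subsystem drops along unstable edges, which pays for the growth by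
        at most \<open>B\<close> there; at stable subsystems \<open>\<tau>\<close> was chosen to pay for the largest rank.\<close>
      define V where "V k = norm (x (t k)) * B ^ ?h (p k)" for k
      have x_le_V: "norm (x (t k)) \<le> V k" for k
        unfolding V_def using B(1) by (simp add: mult_le_cancel_left1)
      have step: "V (Suc k) \<le> V k" for k
      proof -
        let ?\<delta> = "t (Suc k) - t k"
        obtain l where l: "(x \<longlongrightarrow> l) (at_left (t (Suc k)))" "x (t (Suc k)) = R0 *v l"
          using jump by blast
        have "norm l \<le> C (p k) * norm (x (t k)) * exp (- r (p k) * ?\<delta>)"
          by (rule left_limit_bound[OF t_less l(1) flow[OF ode]])
        then have "norm (x (t (Suc k))) \<le> C (p k) * norm (x (t k)) * exp (- r (p k) * ?\<delta>) * K"
          using K order_trans[OF K(2)[of l] mult_right_mono] l(2) by simp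
        also have "\<dots> = norm (x (t k)) * (K * C (p k) * exp (- r (p k) * ?\<delta>))" by simp
        finally have le: "norm (x (t (Suc k))) \<le> norm (x (t k)) * (K * C (p k) * exp (- r (p k) * ?\<delta>))" .
        show ?thesis
        proof (cases "stable_matrix (A (p k))")
          case True
          \<comment> \<open>After a stable subsystem the rank may rise, but never beyond
            \<open>?N\<close>.\<close>
          have "V (Suc k) \<le> norm (x (t k)) * (K * C (p k) * exp (- r (p k) * ?\<delta>)) * B ^ ?N"
            unfolding V_def using le B(1) h_le K C by (intro mult_mono power_increasing) auto
          also have "\<dots> \<le> norm (x (t k)) * (K * C (p k) * exp (- r (p k) * \<tau>)) * B ^ ?N"
            using dwell[OF True] r[OF True] K C[of "p k"] B(1)
            by (intro mult_right_mono mult_left_mono) auto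
          also have "\<dots> = norm (x (t k)) * (K * C (p k) * exp (- r (p k) * \<tau>) * B ^ ?N)" by simp
          also have "\<dots> \<le> norm (x (t k))"
            using \<tau>[OF pP True] by (intro mult_left_le) auto
          also have "\<dots> \<le> V k" by (rule x_le_V)
          finally show ?thesis .
        next
          case False
          have "(p k, p (Suc k)) \<in> G"
            using edge unstable[OF False] by (simp add: G_def unstable_edges_def)
          \<comment> \<open>The strict drop leaves room for exactly one additional factor
            \<open>B\<close>.\<close>
          then have h: "Suc (?h (p (Suc k))) \<le> ?h (p k)"
            using out_rank_less \<open>finite G\<close> assms(5) unfolding G_def by (metis Suc_leI)
          have "K * (C (p k) * exp (- r (p k) * ?\<delta>)) \<le> K * D"
            using K(1) D[OF pP _ flee] t_less[of k] by (intro mult_left_mono) auto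
          then have "K * C (p k) * exp (- r (p k) * ?\<delta>) \<le> B" using B(2) by simp
          then have "norm (x (t (Suc k))) \<le> norm (x (t k)) * B"
            using order_trans[OF le mult_left_mono] by simp
          then have "V (Suc k) \<le> norm (x (t k)) * B * B ^ ?h (p (Suc k))"
            unfolding V_def using B(1) by (intro mult_right_mono) auto
          also have "\<dots> = norm (x (t k)) * B ^ Suc (?h (p (Suc k)))" by simp
          also have "\<dots> \<le> V k"
            unfolding V_def using h B(1) by (intro mult_left_mono power_increasing) auto
          finally show ?thesis .
        qed
      qed
      have "V k \<le> V 0" for k
        using step by (induction k) (auto intro: order_trans)
      moreover have "V 0 \<le> norm (x 0) * B ^ ?N"
        unfolding V_def \<open>t 0 = 0\<close> using h_le B(1) by (intro mult_left_mono power_increasing) auto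
      ultimately have x_le: "norm (x (t k)) \<le> norm (x 0) * B ^ ?N" for k
        using x_le_V by (meson order_trans)
      obtain k where k: "s \<in> {t k..<t (Suc k)}"
        using unbounded_sequence_interval[OF t_top] \<open>s \<ge> 0\<close> \<open>t 0 = 0\<close> by metis
      have "norm (x s) \<le> C (p k) * norm (x (t k)) * exp (- r (p k) * (s - t k))"
        by (rule flow[OF ode k])
      also have "\<dots> = C (p k) * exp (- r (p k) * (s - t k)) * norm (x (t k))" by simp
      also have "\<dots> \<le> D * (norm (x 0) * B ^ ?N)"
      proof (rule mult_mono[OF D[OF pP] x_le])
        show "s - t k \<le> 1" if "\<not> stable_matrix (A (p k))"
          using flee[OF that] k by simp
      qed (use k \<open>D \<ge> 1\<close> in auto)
      finally show ?thesis by (simp add: mult_ac)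
    qed
    have DB: "D * B ^ ?N > 0" using \<open>D \<ge> 1\<close> B(1) by simp
    show ?thesis
      unfolding reset_system_stable_def
    proof (intro allI impI)
      fix \<epsilon> :: real assume "\<epsilon> > 0"
      have "norm (x s) < \<epsilon>" if "reset_solution A (\<lambda>_. R0) \<sigma> x" "norm (x 0) < \<epsilon> / (D * B ^ ?N)" "s > 0" for x s
      proof -
        have "D * B ^ ?N * norm (x 0) < \<epsilon>"
          using that(2) DB by (simp add: pos_less_divide_eq mult.commute)
        with main[OF that(1), of s] \<open>s > 0\<close> show ?thesis by simp
      qed
      then show "\<exists>\<delta>>0. \<forall>x. reset_solution A (\<lambda>_. R0) \<sigma> x \<longrightarrow> norm (x 0) < \<delta> \<longrightarrow> (\<forall>t>0. norm (x t) < \<epsilon>)"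
        using \<open>\<epsilon> > 0\<close> DB by (intro exI[of _ "\<epsilon> / (D * B ^ ?N)"]) auto
    qed
  qed
  have "(\<lambda>_. R0) ` (P \<times> P) \<subseteq> M" using \<open>R0 \<in> M\<close> by auto
  with stable \<open>\<tau> \<ge> 0\<close> show ?thesis by (meson zero_less_one)
qed

end
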